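(* Let $M$ be a monoid and let $A$ be a finite set. Let $X\subset A^M$ be a subshift. Then the following conditions are equivalent: (a) the subshift $X$ is of finite type; (b) the dynamical system $(X,M)$ has the pseudo-orbit tracing property.
   Context: $A^M$ is the set of all maps $M\to A$ with the prodiscrete topology (product topology with each factor $A$ discrete), which is compact Hausdorff. $M$ acts continuously on $A^M$ by the shift $(m x)(m')=x(m'm)$ for $m,m'\in M$, $x\in A^M$. A subshift is a closed $M$-invariant subset $X\subset A^M$ (i.e. $mx\in X$ for all $m\in M$, $x\in X$); $(X,M)$ denotes $X$ with the restricted shift action. A subshift $X$ is of finite type if there exist a finite subset $W\subset M$ and $P\subset A^W$ such that $X=\{x\in A^M : (mx)|_W\in P \text{ for all } m\in M\}$. A compact Hausdorff space carries a unique uniform structure inducing its topology; its entourages are the neighborhoods of the diagonal. Pseudo-orbit tracing property: for a finite $K\subset M$ and an entourage $V$ of $X$, a family $(x_m)_{m\in M}$ of points of $X$ is a $(K,V)$-pseudo-orbit if $(kx_m,x_{km})\in V$ for all $k\in K$, $m\in M$. It is $U$-traced by the orbit of $x\in X$ if $(mx,x_m)\in U$ for all $m\in M$. The system $(X,M)$ has the pseudo-orbit tracing property if for every entourage $U$ of $X$ there exist a finite subset $K\subset M$ and an entourage $V$ of $X$ such that every $(K,V)$-pseudo-orbit is $U$-traced by the orbit of some point of $X$. *)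

theory Defs
  imports "HOL-Analysis.Analysis" "HOL-Algebra.Group"
begin

section \<open>Entourages and the pseudo-orbit tracing property\<close>

text \<open>
  The entourages of the unique compatible uniform structure of a compact Hausdorff space are
  the neighbourhoods of the diagonal. The definition below is used only for such spaces.
\<close>

definition entourage :: "'x topology \<Rightarrow> ('x \<times> 'x) set \<Rightarrow> bool" where
  "entourage T V \<longleftrightarrow>
     V \<subseteq> topspace T \<times> topspace T \<and>
     (\<exists>D. openin (prod_topology T T) D \<and> Id_on (topspace T) \<subseteq> D \<and> D \<subseteq> V)"

definition pseudo_orbit ::
  "('m, 'r) monoid_scheme \<Rightarrow> 'x topology \<Rightarrow> ('m \<Rightarrow> 'x \<Rightarrow> 'x) \<Rightarrow> 'm set \<Rightarrow> ('x \<times> 'x) set \<Rightarrow>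
   ('m \<Rightarrow> 'x) \<Rightarrow> bool" where
  "pseudo_orbit M T act K V xs \<longleftrightarrow>
     xs \<in> carrier M \<rightarrow> topspace T \<and>
     (\<forall>k\<in>K. \<forall>m\<in>carrier M. (act k (xs m), xs (k \<otimes>\<^bsub>M\<^esub> m)) \<in> V)"

definition traced_by ::
  "('m, 'r) monoid_scheme \<Rightarrow> ('m \<Rightarrow> 'x \<Rightarrow> 'x) \<Rightarrow> ('x \<times> 'x) set \<Rightarrow> ('m \<Rightarrow> 'x) \<Rightarrow> 'x \<Rightarrow> bool" where
  "traced_by M act U xs x \<longleftrightarrow> (\<forall>m\<in>carrier M. (act m x, xs m) \<in> U)"

definition pseudo_orbit_tracing ::
  "('m, 'r) monoid_scheme \<Rightarrow> 'x topology \<Rightarrow> ('m \<Rightarrow> 'x \<Rightarrow> 'x) \<Rightarrow> bool" where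
  "pseudo_orbit_tracing M T act \<longleftrightarrow>
     (\<forall>U. entourage T U \<longrightarrow>
       (\<exists>K V. finite K \<and> K \<subseteq> carrier M \<and> entourage T V \<and>
         (\<forall>xs. pseudo_orbit M T act K V xs \<longrightarrow>
           (\<exists>x\<in>topspace T. traced_by M act U xs x))))"

section \<open>Subshifts\<close>

text \<open>
  A configuration is an extensional function on the carrier, i.e. an element of
  \<open>carrier M \<rightarrow>\<^sub>E A\<close>; this is the underlying set of the prodiscrete topology. The alphabet
  is an arbitrary set, so it may be empty.
\<close>

definition prodiscrete :: "('m, 'r) monoid_scheme \<Rightarrow> 'a set \<Rightarrow> ('m \<Rightarrow> 'a) topology" where
  "prodiscrete M A = product_topology (\<lambda>_. discrete_topology A) (carrier M)"

definition shift :: "('m, 'r) monoid_scheme \<Rightarrow> 'm \<Rightarrow> ('m \<Rightarrow> 'a) \<Rightarrow> ('m \<Rightarrow> 'a)" where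
  "shift M m x = (\<lambda>m'\<in>carrier M. x (m' \<otimes>\<^bsub>M\<^esub> m))"

definition subshift :: "('m, 'r) monoid_scheme \<Rightarrow> 'a set \<Rightarrow> ('m \<Rightarrow> 'a) set \<Rightarrow> bool" where
  "subshift M A X \<longleftrightarrow>
     closedin (prodiscrete M A) X \<and> (\<forall>m\<in>carrier M. \<forall>x\<in>X. shift M m x \<in> X)"

definition finite_type :: "('m, 'r) monoid_scheme \<Rightarrow> 'a set \<Rightarrow> ('m \<Rightarrow> 'a) set \<Rightarrow> bool" where
  "finite_type M A X \<longleftrightarrow>
     (\<exists>W P. finite W \<and> W \<subseteq> carrier M \<and> P \<subseteq> (W \<rightarrow>\<^sub>E A) \<and>
       X = {x \<in> carrier M \<rightarrow>\<^sub>E A. \<forall>m\<in>carrier M. restrict (shift M m x) W \<in> P})"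

lemma topspace_prodiscrete: "topspace (prodiscrete M A) = (carrier M \<rightarrow>\<^sub>E A)"
  by (simp add: prodiscrete_def)

lemma compact_space_prodiscrete: "finite A \<Longrightarrow> compact_space (prodiscrete M A)"
  by (simp add: prodiscrete_def compact_space_product_topology compact_space_discrete_topology)

lemma Hausdorff_space_prodiscrete: "Hausdorff_space (prodiscrete M A)"
  by (simp add: prodiscrete_def Hausdorff_space_product_topology Hausdorff_space_discrete_topology)

lemma (in monoid) shift_closed:
  "m \<in> carrier G \<Longrightarrow> x \<in> carrier G \<rightarrow>\<^sub>E A \<Longrightarrow> shift G m x \<in> carrier G \<rightarrow>\<^sub>E A"
  by (auto simp: shift_def)

lemma (in monoid) shift_one: "x \<in> carrier G \<rightarrow>\<^sub>E A \<Longrightarrow> shift G \<one> x = x"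
  by (auto simp: shift_def fun_eq_iff PiE_iff extensional_def)

lemma (in monoid) shift_mult:
  "m \<in> carrier G \<Longrightarrow> n \<in> carrier G \<Longrightarrow> shift G (m \<otimes> n) x = shift G m (shift G n x)"
  by (auto simp: shift_def fun_eq_iff m_assoc)

end

theory Submission
  imports Defs
begin

text \<open>
  Both implications rest on one fact: on a subshift over a finite alphabet the entourages are
  generated by the relations \<open>agreement X F\<close>, "the two configurations coincide on the finite
  window \<open>F\<close>" (\<open>entourage_agreement\<close>, \<open>entourage_contains_agreement\<close>).
  After this translation a pseudo-orbit is a family of configurations \<open>x\<^sub>m\<close> whose overlapping local patterns match, and tracing asks for a single
  configuration that carries all these patterns.

  If \<open>X\<close> has finite type with defining window \<open>W\<close>, and tracing is wanted on the window \<open>F\<close>, it is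
  enough that \<open>k x\<^sub>m\<close> and the member of the family at \<open>k m\<close> agree at \<open>\<one>\<close> for
  \<open>k \<in> W \<union> F\<close>. The tracing configuration is the one whose symbol at \<open>m\<close> is
  \<open>x\<^sub>m(\<one>)\<close>. For \<open>w \<in> W \<union> F\<close> its translate by \<open>m\<close> has at \<open>w\<close> the symbol that the
  member at \<open>w m\<close> has at \<open>\<one>\<close>, which is \<open>(w x\<^sub>m)(\<one>) = x\<^sub>m(w)\<close>. On \<open>W\<close> this shows
  that all its patterns are allowed, so that it lies in \<open>X\<close>; on \<open>F\<close> it is the tracing.

  Conversely, apply tracing with the window \<open>{\<one>}\<close>, and let \<open>K\<close> and \<open>F\<close> describe the
  pseudo-orbits that it handles. The defining window is \<open>W = F \<union> F K \<union> {\<one>}\<close> and the allowed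
  patterns are those that occur in \<open>X\<close>. If all patterns of \<open>x\<close> are allowed, choose \<open>x\<^sub>m \<in> X\<close> with
  the same pattern on \<open>W\<close> as \<open>m x\<close>. The family is a pseudo-orbit because \<open>k x\<^sub>m\<close> and the member
  at \<open>k m\<close> both agree with \<open>k m x\<close> on \<open>F\<close>. A configuration in \<open>X\<close> that traces it on
  \<open>{\<one>}\<close> equals \<open>x\<close>, so \<open>x \<in> X\<close>.
\<close>

section \<open>Entourages of a subshift\<close>

definition cylinder :: "('m \<Rightarrow> 'a) set \<Rightarrow> 'm set \<Rightarrow> ('m \<Rightarrow> 'a) \<Rightarrow> ('m \<Rightarrow> 'a) set" where
  "cylinder X F x = {y \<in> X. \<forall>i\<in>F. y i = x i}"

definition agreement :: "('m \<Rightarrow> 'a) set \<Rightarrow> 'm set \<Rightarrow> (('m \<Rightarrow> 'a) \<times> ('m \<Rightarrow> 'a)) set" where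
  "agreement X F = {(x, y). x \<in> X \<and> y \<in> X \<and> (\<forall>i\<in>F. x i = y i)}"

lemma openin_cylinder:
  assumes "X \<subseteq> carrier M \<rightarrow>\<^sub>E A" "finite F" "F \<subseteq> carrier M" "x \<in> X"
  shows "openin (subtopology (prodiscrete M A) X) (cylinder X F x)"
proof -
  let ?B = "\<lambda>i. if i \<in> F then {x i} else A"
  have "openin (prodiscrete M A) (Pi\<^sub>E (carrier M) ?B)"
    unfolding prodiscrete_def
  proof (rule product_topology_basis)
    show "openin (discrete_topology A) (?B i)" for i
      using assms by (auto simp: PiE_iff)
    show "finite {i. ?B i \<noteq> topspace (discrete_topology A)}"
      by (rule finite_subset[OF _ assms(2)]) auto
  qed
  moreover have "cylinder X F x = X \<inter> Pi\<^sub>E (carrier M) ?B"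
  proof (intro Set.set_eqI iffI)
    fix y assume "y \<in> cylinder X F x"
    then have "y \<in> X" "\<forall>i\<in>F. y i = x i" "y \<in> carrier M \<rightarrow>\<^sub>E A"
      using assms by (auto simp: cylinder_def)
    then show "y \<in> X \<inter> Pi\<^sub>E (carrier M) ?B" by (auto simp: PiE_iff)
  next
    fix y assume "y \<in> X \<inter> Pi\<^sub>E (carrier M) ?B"
    then have "y \<in> X" "\<forall>i\<in>carrier M. y i \<in> ?B i" by (auto simp: PiE_iff)
    then show "y \<in> cylinder X F x" using assms by (fastforce simp: cylinder_def)
  qed
  ultimately show ?thesis
    by (auto simp: openin_subtopology_Int2)
qed

lemma openin_contains_cylinder:
  assumes "X \<subseteq> carrier M \<rightarrow>\<^sub>E A" "openin (subtopology (prodiscrete M A) X) N" "x \<in> N"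
  obtains F where "finite F" "F \<subseteq> carrier M" "cylinder X F x \<subseteq> N"
proof -
  obtain N' where N': "openin (prodiscrete M A) N'" "N = N' \<inter> X"
    using assms by (auto simp: openin_subtopology)
  then have "openin (product_topology (\<lambda>_. discrete_topology A) (carrier M)) N'" "x \<in> N'"
    using assms by (auto simp: prodiscrete_def)
  from product_topology_open_contains_basis[OF this]
  obtain B where B: "x \<in> Pi\<^sub>E (carrier M) B"
    "finite {i. B i \<noteq> topspace (discrete_topology A)}" "Pi\<^sub>E (carrier M) B \<subseteq> N'"
    by blast
  let ?F = "{i \<in> carrier M. B i \<noteq> A}"
  show thesis
  proof (rule that[of "?F"])
    show "finite ?F" by (rule finite_subset[OF _ B(2)]) auto
    show "cylinder X ?F x \<subseteq> N"
    proof
      fix y assume y: "y \<in> cylinder X ?F x"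
      then have yX: "y \<in> X" "y \<in> carrier M \<rightarrow>\<^sub>E A" using assms(1) by (auto simp: cylinder_def)
      have "y i \<in> B i" if "i \<in> carrier M" for i
        using that y yX B(1) by (cases "B i = A") (auto simp: cylinder_def PiE_iff)
      then have "y \<in> Pi\<^sub>E (carrier M) B" using yX(2) by (auto simp: PiE_iff)
      then show "y \<in> N" using B(3) N'(2) yX(1) by blast
    qed
  qed auto
qed

lemma topspace_subshift:
  assumes "X \<subseteq> carrier M \<rightarrow>\<^sub>E A"
  shows "topspace (subtopology (prodiscrete M A) X) = X"
  using assms by (auto simp: topspace_prodiscrete)

lemma entourage_agreement:
  assumes "X \<subseteq> carrier M \<rightarrow>\<^sub>E A" "finite F" "F \<subseteq> carrier M"
  shows "entourage (subtopology (prodiscrete M A) X) (agreement X F)"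
proof -
  let ?T = "subtopology (prodiscrete M A) X"
  have "openin (prod_topology ?T ?T) (agreement X F)"
    unfolding openin_prod_topology_alt
  proof (intro allI impI)
    fix x y assume "(x, y) \<in> agreement X F"
    then have "x \<in> X" "y \<in> X" "\<forall>i\<in>F. x i = y i" by (auto simp: agreement_def)
    moreover from this have "x \<in> cylinder X F x" "y \<in> cylinder X F x" "cylinder X F x \<times> cylinder X F x \<subseteq> agreement X F"
      by (auto simp: cylinder_def agreement_def)
    ultimately show "\<exists>U V. openin ?T U \<and> openin ?T V \<and> x \<in> U \<and> y \<in> V \<and> U \<times> V \<subseteq> agreement X F"
      using openin_cylinder[OF assms] by blast
  qed
  then show ?thesis
    using assms unfolding entourage_def topspace_subshift[OF assms(1)]
    by (intro conjI exI[of _ "agreement X F"]) (auto simp: agreement_def)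
qed

text \<open>
  Every point of the diagonal has a cylinder whose square lies in the entourage. By compactness
  finitely many of these cylinders cover the space, and the union of their windows works for all
  points at once: two configurations that agree on it lie in the same cylinders of the cover.
\<close>

lemma entourage_contains_agreement:
  assumes X: "X \<subseteq> carrier M \<rightarrow>\<^sub>E A" and cpt: "compact_space (subtopology (prodiscrete M A) X)"
    and V: "entourage (subtopology (prodiscrete M A) X) V"
  obtains F where "finite F" "F \<subseteq> carrier M" "agreement X F \<subseteq> V"
proof -
  let ?T = "subtopology (prodiscrete M A) X"
  note top = topspace_subshift[OF X]
  obtain D where D: "openin (prod_topology ?T ?T) D" "Id_on X \<subseteq> D" "D \<subseteq> V"
    using V unfolding entourage_def top by blast
  have "\<forall>x\<in>X. \<exists>F. finite F \<and> F \<subseteq> carrier M \<and> cylinder X F x \<times> cylinder X F x \<subseteq> D"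
  proof
    fix x assume x: "x \<in> X"
    have "(x, x) \<in> D" using D(2) x by auto
    then have "\<exists>N N'. openin ?T N \<and> openin ?T N' \<and> x \<in> N \<and> x \<in> N' \<and> N \<times> N' \<subseteq> D"
      by (rule D(1)[unfolded openin_prod_topology_alt, rule_format])
    then obtain N N' where N: "openin ?T N" "openin ?T N'" "x \<in> N \<inter> N'" "N \<times> N' \<subseteq> D"
      by (elim exE conjE) auto
    obtain F where F: "finite F" "F \<subseteq> carrier M" "cylinder X F x \<subseteq> N \<inter> N'"
      using openin_contains_cylinder[OF X openin_Int[OF N(1,2)] N(3)] .
    from F(3) have "cylinder X F x \<times> cylinder X F x \<subseteq> N \<times> N'" by (intro Sigma_mono) auto
    then show "\<exists>F. finite F \<and> F \<subseteq> carrier M \<and> cylinder X F x \<times> cylinder X F x \<subseteq> D"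
      using F(1,2) N(4) by (intro exI[of _ F] conjI order_trans[OF _ N(4)])
  qed
  then obtain F where "\<forall>x\<in>X. finite (F x) \<and> F x \<subseteq> carrier M \<and>
      cylinder X (F x) x \<times> cylinder X (F x) x \<subseteq> D"
    by (rule bchoice[THEN exE])
  then have F: "\<And>x. x \<in> X \<Longrightarrow> finite (F x)" "\<And>x. x \<in> X \<Longrightarrow> F x \<subseteq> carrier M"
    "\<And>x. x \<in> X \<Longrightarrow> cylinder X (F x) x \<times> cylinder X (F x) x \<subseteq> D"
    by simp_all
  have "compactin ?T X" using cpt unfolding compact_space_def top .
  moreover have "\<And>U. U \<in> (\<lambda>x. cylinder X (F x) x) ` X \<Longrightarrow> openin ?T U"
    using openin_cylinder[OF X] F(1,2) by auto
  moreover have "X \<subseteq> \<Union>((\<lambda>x. cylinder X (F x) x) ` X)" by (auto simp: cylinder_def)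
  ultimately obtain \<F> where \<F>: "finite \<F>" "\<F> \<subseteq> (\<lambda>x. cylinder X (F x) x) ` X" "X \<subseteq> \<Union>\<F>"
    by (meson compactinD)
  obtain C where C: "C \<subseteq> X" "finite C" "\<F> = (\<lambda>x. cylinder X (F x) x) ` C"
    using finite_subset_image[OF \<F>(1,2)] by (elim exE conjE)
  have cover: "X \<subseteq> (\<Union>x\<in>C. cylinder X (F x) x)" using \<F>(3) unfolding C(3) .
  show thesis
  proof (rule that)
    show "finite (\<Union>x\<in>C. F x)" "(\<Union>x\<in>C. F x) \<subseteq> carrier M"
      using C(1,2) F(1,2) by auto
    show "agreement X (\<Union>x\<in>C. F x) \<subseteq> V"
    proof clarify
      fix y z assume yz: "(y, z) \<in> agreement X (\<Union>x\<in>C. F x)"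
      then have "y \<in> X" by (simp add: agreement_def)
      then obtain x where x: "x \<in> C" "y \<in> cylinder X (F x) x"
        using cover by blast
      then have "z \<in> cylinder X (F x) x"
        using yz by (auto simp: agreement_def cylinder_def)
      with x(2) have "(y, z) \<in> cylinder X (F x) x \<times> cylinder X (F x) x" by simp
      then show "(y, z) \<in> V" using F(3)[of x] x(1) C(1) D(3) by (meson subsetD)
    qed
  qed
qed

section \<open>Finite type and pseudo-orbit tracing\<close>

text \<open>
  The symbol of a configuration at \<open>m\<close> is the symbol of its translate by \<open>m\<close> at \<open>\<one>\<close>. This is
  why the one-point window \<open>{\<one>}\<close> suffices below.
\<close>

lemma (in monoid) configuration_eqI:
  assumes "x \<in> carrier G \<rightarrow>\<^sub>E A" "y \<in> carrier G \<rightarrow>\<^sub>E A"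
    and "\<And>m. m \<in> carrier G \<Longrightarrow> shift G m x \<one> = shift G m y \<one>"
  shows "x = y"
  using assms(1,2)
proof (rule PiE_ext)
  fix m assume "m \<in> carrier G"
  then show "x m = y m" using assms(3)[of m] by (simp add: shift_def)
qed

text \<open>
  The pseudo-orbit condition is imposed only at \<open>\<one>\<close>, but for all \<open>k \<in> W \<union> F\<close>: it turns the
  symbol at \<open>\<one>\<close> of the member at \<open>k m\<close> into the symbol at \<open>k\<close> of the member at \<open>m\<close>. So the
  diagonal configuration \<open>m \<mapsto> x\<^sub>m(\<one>)\<close> reproduces every member on \<open>W \<union> F\<close>.
\<close>

lemma (in monoid) finite_type_imp_pseudo_orbit_tracing:
  assumes X: "X \<subseteq> carrier G \<rightarrow>\<^sub>E A" and cpt: "compact_space (subtopology (prodiscrete G A) X)"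
    and inv: "\<And>m x. m \<in> carrier G \<Longrightarrow> x \<in> X \<Longrightarrow> shift G m x \<in> X"
    and ft: "finite_type G A X"
  shows "pseudo_orbit_tracing G (subtopology (prodiscrete G A) X) (shift G)"
  unfolding pseudo_orbit_tracing_def topspace_subshift[OF X]
proof (intro allI impI)
  let ?T = "subtopology (prodiscrete G A) X"
  fix U assume "entourage ?T U"
  then obtain F where F: "finite F" "F \<subseteq> carrier G" "agreement X F \<subseteq> U"
    using entourage_contains_agreement[OF X cpt] by blast
  obtain W P where W: "finite W" "W \<subseteq> carrier G"
    and XP: "X = {x \<in> carrier G \<rightarrow>\<^sub>E A. \<forall>m\<in>carrier G. restrict (shift G m x) W \<in> P}"
    using ft unfolding finite_type_def by blast
  let ?K = "W \<union> F" and ?V = "agreement X {\<one>}"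
  have "\<exists>x\<in>X. traced_by G (shift G) U xs x" if po: "pseudo_orbit G ?T (shift G) ?K ?V xs" for xs
  proof -
    have xs: "xs m \<in> X" if "m \<in> carrier G" for m
      using po that unfolding pseudo_orbit_def topspace_subshift[OF X] by blast
    then have xsA: "xs m \<in> carrier G \<rightarrow>\<^sub>E A" if "m \<in> carrier G" for m
      using that X by blast
    define x where "x = (\<lambda>m\<in>carrier G. xs m \<one>)"
    have xA: "x \<in> carrier G \<rightarrow>\<^sub>E A"
      using xsA by (auto simp: x_def)
    have eq: "shift G m x w = xs m w" if "m \<in> carrier G" "w \<in> ?K" for m w
    proof -
      have w: "w \<in> carrier G" using that(2) F(2) W(2) by blast
      have "(shift G w (xs m), xs (w \<otimes> m)) \<in> ?V"
        using po that unfolding pseudo_orbit_def by blast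
      then show ?thesis
        using w that(1) by (simp add: agreement_def shift_def x_def)
    qed
    have "restrict (shift G m x) W \<in> P" if m: "m \<in> carrier G" for m
    proof -
      have "restrict (shift G m x) W = restrict (xs m) W"
        by (rule restrict_ext) (simp add: eq m)
      \<comment> \<open>The pattern is now that of a point of \<open>X\<close>, so it occurs among its allowed patterns.\<close>
      also have "\<dots> = restrict (shift G \<one> (xs m)) W"
        using shift_one[OF xsA[OF m]] by simp
      also have "\<dots> \<in> P"
        using xs[OF m] XP by blast
      finally show ?thesis .
    qed
    then have xX: "x \<in> X" using xA XP by blast
    have "(shift G m x, xs m) \<in> agreement X F" if "m \<in> carrier G" for m
      using that xX xs inv eq by (simp add: agreement_def)
    then have "traced_by G (shift G) U xs x"
      using F(3) unfolding traced_by_def by blast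
    then show ?thesis using xX by blast
  qed
  moreover have "entourage ?T ?V" by (rule entourage_agreement[OF X]) auto
  ultimately show "\<exists>K V. finite K \<and> K \<subseteq> carrier G \<and> entourage ?T V \<and>
      (\<forall>xs. pseudo_orbit G ?T (shift G) K V xs \<longrightarrow> (\<exists>x\<in>X. traced_by G (shift G) U xs x))"
    using F W by (intro exI[of _ ?K] exI[of _ ?V]) auto
qed

text \<open>
  A configuration with locally admissible patterns is approximated along its orbit by points of
  \<open>X\<close>. On a large enough window these form a pseudo-orbit, and a point of \<open>X\<close> that traces it so
  finely as to match at \<open>\<one>\<close> is the configuration itself.
\<close>

lemma (in monoid) pseudo_orbit_tracing_imp_finite_type:
  assumes X: "X \<subseteq> carrier G \<rightarrow>\<^sub>E A" and cpt: "compact_space (subtopology (prodiscrete G A) X)"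
    and inv: "\<And>m x. m \<in> carrier G \<Longrightarrow> x \<in> X \<Longrightarrow> shift G m x \<in> X"
    and pot: "pseudo_orbit_tracing G (subtopology (prodiscrete G A) X) (shift G)"
  shows "finite_type G A X"
proof -
  let ?T = "subtopology (prodiscrete G A) X"
  let ?E = "agreement X {\<one>}"
  have "entourage ?T ?E" by (rule entourage_agreement[OF X]) auto
  then have "\<exists>K V. finite K \<and> K \<subseteq> carrier G \<and> entourage ?T V \<and>
      (\<forall>xs. pseudo_orbit G ?T (shift G) K V xs \<longrightarrow> (\<exists>x\<in>X. traced_by G (shift G) ?E xs x))"
    by (rule pot[unfolded pseudo_orbit_tracing_def topspace_subshift[OF X], THEN spec, THEN mp])
  then obtain K V where K: "finite K" "K \<subseteq> carrier G" and V: "entourage ?T V"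
    and tr: "\<forall>xs. pseudo_orbit G ?T (shift G) K V xs \<longrightarrow>
      (\<exists>x\<in>X. traced_by G (shift G) ?E xs x)"
    by (elim exE conjE)
  obtain F where F: "finite F" "F \<subseteq> carrier G" "agreement X F \<subseteq> V"
    using entourage_contains_agreement[OF X cpt V] .
  \<comment> \<open>The pseudo-orbit estimate reads the patterns on \<open>F K\<close> at \<open>m\<close> and on \<open>F\<close> at \<open>k m\<close>; the
    comparison with the tracing point reads them at \<open>\<one>\<close>.\<close>
  define W where "W = F \<union> (\<lambda>(f, k). f \<otimes> k) ` (F \<times> K) \<union> {\<one>}"
  define P where "P = (\<lambda>x. restrict x W) ` X"
  have W: "finite W" "W \<subseteq> carrier G"
    using F K by (auto simp: W_def)
  have P: "P \<subseteq> W \<rightarrow>\<^sub>E A"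
    using X W(2) by (fastforce simp: P_def PiE_iff)
  have "x \<in> X" if x: "x \<in> carrier G \<rightarrow>\<^sub>E A"
    and pat: "\<forall>m\<in>carrier G. restrict (shift G m x) W \<in> P" for x
  proof -
    have "\<forall>m\<in>carrier G. \<exists>y\<in>X. \<forall>w\<in>W. y w = shift G m x w"
    proof
      fix m assume "m \<in> carrier G"
      then obtain y where "y \<in> X" "restrict (shift G m x) W = restrict y W"
        using pat unfolding P_def by blast
      moreover from this have "y w = shift G m x w" if "w \<in> W" for w
        using that by (metis restrict_apply')
      ultimately show "\<exists>y\<in>X. \<forall>w\<in>W. y w = shift G m x w" by blast
    qed
    then obtain xs where xs: "\<And>m. m \<in> carrier G \<Longrightarrow> xs m \<in> X"
      and xsW: "\<And>m w. m \<in> carrier G \<Longrightarrow> w \<in> W \<Longrightarrow> xs m w = shift G m x w"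
      by metis
    have "(shift G k (xs m), xs (k \<otimes> m)) \<in> agreement X F"
      if k: "k \<in> K" and m: "m \<in> carrier G" for k m
    proof -
      have kG: "k \<in> carrier G" using k K(2) by blast
      have "shift G k (xs m) f = xs (k \<otimes> m) f" if f: "f \<in> F" for f
      proof -
        have fG: "f \<in> carrier G" using f F(2) by blast
        have "f \<otimes> k \<in> W" "f \<in> W" using f k by (auto simp: W_def)
        then show ?thesis using kG fG m by (simp add: shift_def xsW m_assoc)
      qed
      then show ?thesis using xs inv kG m by (simp add: agreement_def)
    qed
    then have "pseudo_orbit G ?T (shift G) K V xs"
      using F(3) xs unfolding pseudo_orbit_def topspace_subshift[OF X] by blast
    then obtain y where y: "y \<in> X" "traced_by G (shift G) ?E xs y"
      using tr by blast
    have "y = x"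
    proof (rule configuration_eqI)
      show "y \<in> carrier G \<rightarrow>\<^sub>E A" using y(1) X by blast
      show "shift G m y \<one> = shift G m x \<one>" if "m \<in> carrier G" for m
        using y(2) xsW[of m \<one>] that by (auto simp: traced_by_def agreement_def W_def)
    qed (rule x)
    then show "x \<in> X" using y(1) by simp
  qed
  then have "X = {x \<in> carrier G \<rightarrow>\<^sub>E A. \<forall>m\<in>carrier G. restrict (shift G m x) W \<in> P}"
    using X inv by (auto simp: P_def)
  then show ?thesis using W P unfolding finite_type_def by blast
qed

theorem theorem1p2:
  fixes M :: "('m, 'r) monoid_scheme" and A :: "'a set" and X :: "('m \<Rightarrow> 'a) set"
  assumes "monoid M" and "finite A" and "subshift M A X"
  shows "finite_type M A X \<longleftrightarrow>
    pseudo_orbit_tracing M (subtopology (prodiscrete M A) X) (shift M)"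
proof -
  interpret monoid M by fact
  have cl: "closedin (prodiscrete M A) X"
    and inv: "\<And>m x. m \<in> carrier M \<Longrightarrow> x \<in> X \<Longrightarrow> shift M m x \<in> X"
    using assms(3) unfolding subshift_def by auto
  have X: "X \<subseteq> carrier M \<rightarrow>\<^sub>E A"
    using closedin_subset[OF cl] by (simp add: topspace_prodiscrete)
  have cpt: "compact_space (subtopology (prodiscrete M A) X)"
    using closedin_compact_space[OF compact_space_prodiscrete[OF assms(2)] cl]
    by (rule compact_space_subtopology)
  show ?thesis
  proof
    assume "finite_type M A X"
    then show "pseudo_orbit_tracing M (subtopology (prodiscrete M A) X) (shift M)"
      using finite_type_imp_pseudo_orbit_tracing[OF X cpt] inv by blast
  next
    assume "pseudo_orbit_tracing M (subtopology (prodiscrete M A) X) (shift M)"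
    then show "finite_type M A X"
      using pseudo_orbit_tracing_imp_finite_type[OF X cpt] inv by blast
  qed
qed

end
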